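(* The packing density (in the unrestricted sense) of the set partition $121$, i.e. of $\{\{1,3\},\{2\}\}$, is $$\delta(121)=\frac14.$$
   Context: Let $[n]=\{1,\dots,n\}$. A partition of $[n]$ into disjoint nonempty blocks $B_1/B_2/\cdots/B_t$, ordered so that $\min B_1<\min B_2<\cdots<\min B_t$, is identified with the word $\pi_1\pi_2\cdots\pi_n$ where $\pi_i=j$ iff $i\in B_j$. $\Pi_{n,k}$ is the set of partitions of $[n]$ (as words) with at most $k$ blocks. The canonization of a word is obtained by replacing all occurrences of the first letter by 1, all occurrences of the second distinct letter to appear by 2, and so on. $\nu(121,\sigma)$ is the number of copies of $121$ in $\sigma=\sigma_1\cdots\sigma_n$ in the unrestricted sense: the number of triples of positions $i_1<i_2<i_3$ such that the canonization of $\sigma_{i_1}\sigma_{i_2}\sigma_{i_3}$ is $121$ (equivalently $\sigma_{i_1}=\sigma_{i_3}\neq\sigma_{i_2}$). For $n\ge 3$ define $$\delta(121,n,k)=\frac{\max\{\nu(121,\pi):\pi\in\Pi_{n,k}\}}{\binom n3},\qquad \delta(121)=\lim_{n\to\infty}\lim_{k\to\infty}\delta(121,n,k).$$ *)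

theory Defs
  imports Complex_Main "HOL-Library.Disjoint_Sets"
begin

text \<open>Words are lists of natural numbers. List positions start at 0, whereas
  the elements of \<open>[n]\<close> and the letters of a partition word start at 1, hence
  the shifts by 1 below.\<close>

definition ordered_blocks :: "nat \<Rightarrow> nat set list \<Rightarrow> bool" where
  "ordered_blocks n Bs \<longleftrightarrow>
     partition_on {1..n} (set Bs) \<and> sorted_wrt (\<lambda>A B. Min A < Min B) Bs"

definition is_partition_word :: "nat \<Rightarrow> nat set list \<Rightarrow> nat list \<Rightarrow> bool" where
  "is_partition_word n Bs w \<longleftrightarrow>
     length w = n \<and>
     (\<forall>i\<in>{1..n}. \<forall>j\<in>{1..length Bs}. w ! (i - 1) = j \<longleftrightarrow> i \<in> Bs ! (j - 1))"

definition partition_words :: "nat \<Rightarrow> nat \<Rightarrow> nat list set" where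
  "partition_words n k =
     {w. \<exists>Bs. ordered_blocks n Bs \<and> length Bs \<le> k \<and> is_partition_word n Bs w}"

text \<open>The letter \<open>x\<close> is replaced by one plus the number of distinct letters that
  occur before its first occurrence.\<close>

definition canonization :: "'a list \<Rightarrow> nat list" where
  "canonization w = map (\<lambda>x. card (set (takeWhile (\<lambda>y. y \<noteq> x) w)) + 1) w"

text \<open>A copy is a set of positions; \<open>nths\<close> lists the letters at these positions
  in increasing order of position.\<close>

definition copies :: "nat list \<Rightarrow> 'a list \<Rightarrow> nat" where
  "copies p w =
     card {I. I \<subseteq> {..<length w} \<and> card I = length p \<and> canonization (nths w I) = p}"

text \<open>For \<open>n \<ge> 1\<close> and \<open>k = 0\<close> the maximum is over the empty set and hence unspecified;
  this does not affect the limit in \<open>k\<close>.\<close>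

definition max_density :: "nat list \<Rightarrow> nat \<Rightarrow> nat \<Rightarrow> real" where
  "max_density p n k =
     real (Max (copies p ` partition_words n k)) / real (n choose length p)"

definition packing_density :: "nat list \<Rightarrow> real" where
  "packing_density p = lim (\<lambda>n. lim (\<lambda>k. max_density p n k))"

lemma ordered_blocks_121: "ordered_blocks 3 [{1, 3}, {2}]"
  by (auto simp: ordered_blocks_def partition_on_def disjoint_def)

lemma is_partition_word_121: "is_partition_word 3 [{1, 3}, {2}] [1, 2, 1]"
proof -
  have "{Suc 0..3} = {1, 2, 3}" "{Suc 0..Suc (Suc 0)} = {1, 2}"
    by auto
  then show ?thesis
    by (simp add: is_partition_word_def)
qed

end

theory Submission
  imports Defs
begin

text \<open>
  For a position \<open>x\<close> of a word let \<open>b\<close> and \<open>a\<close> be the numbers of positions before and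
  after \<open>x\<close> that carry the same letter as \<open>x\<close>, and let \<open>b'\<close> and \<open>a'\<close> be the numbers of
  positions before and after \<open>x\<close> that carry a different letter. The proof rests on the identity
  \<open>2 \<nu> = \<Sum>x. (b - a) (b' - a')\<close>, where \<open>\<nu>\<close> is the number of copies of \<open>121\<close>
  (\<open>card_triples_121\<close>). To see it, expand the product and count each term by triples with
  exactly two equal letters: \<open>b b'\<close> has \<open>x\<close> as last position and counts \<open>121\<close> and \<open>211\<close>;
  \<open>a a'\<close> has \<open>x\<close> as first position and counts \<open>121\<close> and \<open>112\<close>; the mixed terms have \<open>x\<close> in
  the middle and count \<open>211\<close> and \<open>112\<close>. Everything but \<open>121\<close> cancels.

  The two factors have the fixed sum \<open>x - (n - 1 - x) = 2 x + 1 - n\<close>, whatever the word is. So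
  each product is at most \<open>(2 x + 1 - n)\<^sup>2 / 4\<close>, and summing gives
  \<open>\<nu> \<le> n (n\<^sup>2 - 1) / 24\<close> for every word of length \<open>n\<close> over any alphabet
  (\<open>copies_121_le\<close>). Near-equality requires \<open>b - a\<close> and \<open>b' - a'\<close> to be nearly equal at each
  position, which the alternating word \<open>1212\<dots>\<close> achieves: there they differ by at most 1, so at
  most \<open>n / 8\<close> copies are lost (\<open>copies_121_alternating_ge\<close>). As \<open>n choose 3\<close> is asymptotically
  \<open>n\<^sup>3 / 6\<close>, both bounds give the density \<open>1 / 4\<close>.

  The limit in \<open>k\<close> is attained at \<open>k = n\<close>, because a partition of an \<open>n\<close>-element set has at
  most \<open>n\<close> blocks.
\<close>

section \<open>Copies as triples of positions\<close>

lemma nths_eq_map_nth: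
  assumes "I \<subseteq> {..<length w}"
  shows "nths w I = map ((!) w) (sorted_list_of_set I)"
proof -
  have "zip w [0..<length w] = map (\<lambda>i. (w ! i, i)) [0..<length w]"
    by (rule nth_equalityI) auto
  then have "nths w I = map ((!) w) (filter (\<lambda>i. i \<in> I) [0..<length w])"
    by (simp add: nths_def filter_map comp_def)
  moreover have "filter (\<lambda>i. i \<in> I) [0..<length w] = sorted_list_of_set I"
  proof (rule sorted_distinct_set_unique)
    have "finite I"
      using assms finite_subset by blast
    then show "set (filter (\<lambda>i. i \<in> I) [0..<length w]) = set (sorted_list_of_set I)"
      using assms by auto
    show "sorted (filter (\<lambda>i. i \<in> I) [0..<length w])"
      by (rule sorted_wrt_filter) simp
  qed simp_all
  ultimately show ?thesis
    by simp
qed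

lemma canonization_eq_121_iff:
  "canonization [x, y, z] = [1, 2, 1] \<longleftrightarrow> z = x \<and> y \<noteq> x"
  using [[simproc del: list_to_set_comprehension]]
  by (simp add: canonization_def)

definition triples_121 :: "(nat \<Rightarrow> 'a) \<Rightarrow> nat \<Rightarrow> (nat \<times> nat \<times> nat) set" where
  "triples_121 f n = {(i, j, k). i < j \<and> j < k \<and> k < n \<and> f i = f k \<and> f j \<noteq> f i}"

definition triples_112 :: "(nat \<Rightarrow> 'a) \<Rightarrow> nat \<Rightarrow> (nat \<times> nat \<times> nat) set" where
  "triples_112 f n = {(i, j, k). i < j \<and> j < k \<and> k < n \<and> f i = f j \<and> f k \<noteq> f i}"

definition triples_211 :: "(nat \<Rightarrow> 'a) \<Rightarrow> nat \<Rightarrow> (nat \<times> nat \<times> nat) set" where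
  "triples_211 f n = {(i, j, k). i < j \<and> j < k \<and> k < n \<and> f j = f k \<and> f i \<noteq> f j}"

lemma finite_triples:
  "finite (triples_121 f n)" "finite (triples_112 f n)" "finite (triples_211 f n)"
  unfolding triples_121_def triples_112_def triples_211_def
  by (rule finite_subset[of _ "{..<n} \<times> {..<n} \<times> {..<n}"]; force)+

lemma sorted_list_of_set_triple:
  fixes i j k :: nat
  assumes "i < j" "j < k"
  shows "sorted_list_of_set {i, j, k} = [i, j, k]"
  using assms by (intro sorted_distinct_set_unique) auto

text \<open>A copy is a set of positions; listing it in increasing order turns the copies into triples,
  on which the letters can be compared directly.\<close>

lemma copies_121: "copies [1, 2, 1] w = card (triples_121 ((!) w) (length w))"
proof -
  define h :: "nat \<times> nat \<times> nat \<Rightarrow> nat set" where "h = (\<lambda>(i, j, k). {i, j, k})"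
  let ?T = "triples_121 ((!) w) (length w)"
  have "inj_on h ?T"
  proof (rule inj_onI)
    fix s t assume *: "s \<in> ?T" "t \<in> ?T" "h s = h t"
    obtain i j k where s: "s = (i, j, k)" by (cases s)
    obtain i' j' k' where t: "t = (i', j', k')" by (cases t)
    have "[i, j, k] = sorted_list_of_set (h s)" "[i', j', k'] = sorted_list_of_set (h t)"
      using *(1,2) s t by (simp_all add: h_def triples_121_def sorted_list_of_set_triple)
    then have "[i, j, k] = [i', j', k']"
      using *(3) by simp
    then show "s = t"
      using s t by simp
  qed
  moreover have "{I. I \<subseteq> {..<length w} \<and> card I = length [1, 2, 1 :: nat] \<and>
      canonization (nths w I) = [1, 2, 1]} = h ` ?T" (is "?C = _")
  proof (intro equalityI subsetI)
    fix I assume "I \<in> ?C"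
    then have I: "I \<subseteq> {..<length w}" "card I = 3" "canonization (nths w I) = [1, 2, 1]"
      by auto
    then have fin: "finite I"
      using finite_subset by blast
    have "length (sorted_list_of_set I) = 3"
      using I by simp
    then obtain i j k where ijk: "sorted_list_of_set I = [i, j, k]"
      unfolding numeral_3_eq_3 length_Suc_conv by auto
    have less: "i < j" "j < k"
      using strict_sorted_list_of_set[of I] ijk by auto
    have set: "I = {i, j, k}"
      using set_sorted_list_of_set[OF fin] ijk by auto
    have "canonization [w ! i, w ! j, w ! k] = [1, 2, 1]"
      using I(1,3) by (simp only: nths_eq_map_nth ijk list.map)
    then have "w ! k = w ! i \<and> w ! j \<noteq> w ! i"
      by (rule iffD1[OF canonization_eq_121_iff])
    then have "(i, j, k) \<in> ?T"
      using less set I(1) by (auto simp: triples_121_def)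
    then show "I \<in> h ` ?T"
      using set by (force simp: h_def)
  next
    fix I assume "I \<in> h ` ?T"
    then obtain i j k where ijk: "(i, j, k) \<in> ?T" "I = {i, j, k}"
      by (auto simp: h_def)
    then have less: "i < j" "j < k" "k < length w" and eq: "w ! k = w ! i \<and> w ! j \<noteq> w ! i"
      by (auto simp: triples_121_def)
    have sub: "I \<subseteq> {..<length w}"
      using ijk(2) less by auto
    then have "nths w I = [w ! i, w ! j, w ! k]"
      using ijk(2) less by (simp add: nths_eq_map_nth sorted_list_of_set_triple)
    then have "canonization (nths w I) = [1, 2, 1]"
      using iffD2[OF canonization_eq_121_iff eq] by (simp only:)
    then show "I \<in> ?C"
      using sub ijk(2) less by auto
  qed
  ultimately show ?thesis
    by (simp add: copies_def card_image)
qed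

section \<open>Counting the copies of 121 position by position\<close>

definition same_before :: "(nat \<Rightarrow> 'a) \<Rightarrow> nat \<Rightarrow> nat set" where
  "same_before f x = {y. y < x \<and> f y = f x}"

definition diff_before :: "(nat \<Rightarrow> 'a) \<Rightarrow> nat \<Rightarrow> nat set" where
  "diff_before f x = {y. y < x \<and> f y \<noteq> f x}"

definition same_after :: "(nat \<Rightarrow> 'a) \<Rightarrow> nat \<Rightarrow> nat \<Rightarrow> nat set" where
  "same_after f n x = {y. x < y \<and> y < n \<and> f y = f x}"

definition diff_after :: "(nat \<Rightarrow> 'a) \<Rightarrow> nat \<Rightarrow> nat \<Rightarrow> nat set" where
  "diff_after f n x = {y. x < y \<and> y < n \<and> f y \<noteq> f x}"

lemmas around_defs = same_before_def diff_before_def same_after_def diff_after_def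

lemma finite_around:
  "finite (same_before f x)" "finite (diff_before f x)"
  "finite (same_after f n x)" "finite (diff_after f n x)"
  by (auto simp: around_defs)

lemma card_before: "card (same_before f x) + card (diff_before f x) = x"
proof -
  have "card (same_before f x) + card (diff_before f x) = card (same_before f x \<union> diff_before f x)"
    by (subst card_Un_disjoint) (auto simp: around_defs)
  also have "same_before f x \<union> diff_before f x = {..<x}"
    by (auto simp: around_defs)
  finally show ?thesis
    by simp
qed

lemma card_after: "card (same_after f n x) + card (diff_after f n x) = n - 1 - x"
proof -
  have "card (same_after f n x) + card (diff_after f n x) =
      card (same_after f n x \<union> diff_after f n x)"
    by (subst card_Un_disjoint) (auto simp: around_defs)
  also have "same_after f n x \<union> diff_after f n x = {x<..<n}"
    by (auto simp: around_defs)
  finally show ?thesis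
    by simp
qed

lemma sum_card_mult:
  assumes "\<And>x. finite (A x)" "\<And>x. finite (B x)"
  shows "(\<Sum>x<n::nat. card (A x) * card (B x)) = card (SIGMA x:{..<n}. A x \<times> B x)"
  using assms by (simp add: card_cartesian_product)

text \<open>In the next two lemmas \<open>x\<close> is an end of the triple. The other two positions, one with the
  same and one with a different letter, lie on the same side of \<open>x\<close> and are distinct; which of
  them is nearer to \<open>x\<close> decides between the two patterns.\<close>

lemma sum_before_before:
  "(\<Sum>x<n. card (same_before f x) * card (diff_before f x)) =
     card (triples_121 f n) + card (triples_211 f n)"
proof -
  let ?g = "\<lambda>(i, j, k). (k, i, j)" and ?h = "\<lambda>(i, j, k). (k, j, i)"
  have "(SIGMA x:{..<n}. same_before f x \<times> diff_before f x) =
      ?g ` triples_121 f n \<union> ?h ` triples_211 f n"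
  proof (intro equalityI subsetI)
    fix p assume "p \<in> (SIGMA x:{..<n}. same_before f x \<times> diff_before f x)"
    then obtain x y z where p: "p = (x, y, z)" and xyz: "x < n" "y < x" "z < x" "f y = f x" "f z \<noteq> f x"
      by (auto simp: around_defs)
    then have "y \<noteq> z"
      by auto
    then have "y < z \<or> z < y"
      by (simp only: neq_iff)
    then have "(y, z, x) \<in> triples_121 f n \<or> (z, y, x) \<in> triples_211 f n"
      using xyz by (auto simp: triples_121_def triples_211_def)
    then show "p \<in> ?g ` triples_121 f n \<union> ?h ` triples_211 f n"
      using p by force
  qed (auto simp: around_defs triples_121_def triples_211_def)
  moreover have "?g ` triples_121 f n \<inter> ?h ` triples_211 f n = {}"
    by (auto simp: triples_121_def triples_211_def)
  moreover have "card (?g ` triples_121 f n) = card (triples_121 f n)"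
      "card (?h ` triples_211 f n) = card (triples_211 f n)"
    by (intro card_image inj_onI; auto)+
  ultimately show ?thesis
    by (simp add: sum_card_mult finite_around card_Un_disjoint finite_triples)
qed

lemma sum_after_after:
  "(\<Sum>x<n. card (same_after f n x) * card (diff_after f n x)) =
     card (triples_121 f n) + card (triples_112 f n)"
proof -
  let ?g = "\<lambda>(i, j, k). (i, k, j)"
  have "(SIGMA x:{..<n}. same_after f n x \<times> diff_after f n x) =
      ?g ` triples_121 f n \<union> triples_112 f n"
  proof (intro equalityI subsetI)
    fix p assume "p \<in> (SIGMA x:{..<n}. same_after f n x \<times> diff_after f n x)"
    then obtain x y z where p: "p = (x, y, z)" and xyz: "x < y" "x < z" "y < n" "z < n" "f y = f x" "f z \<noteq> f x"
      by (auto simp: around_defs)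
    then have "y \<noteq> z"
      by auto
    then have "y < z \<or> z < y"
      by (simp only: neq_iff)
    then have "(x, z, y) \<in> triples_121 f n \<or> (x, y, z) \<in> triples_112 f n"
      using xyz by (auto simp: triples_121_def triples_112_def)
    then show "p \<in> ?g ` triples_121 f n \<union> triples_112 f n"
      using p by force
  qed (auto simp: around_defs triples_121_def triples_112_def)
  moreover have "?g ` triples_121 f n \<inter> triples_112 f n = {}"
    by (auto simp: triples_121_def triples_112_def)
  moreover have "card (?g ` triples_121 f n) = card (triples_121 f n)"
    by (intro card_image inj_onI; auto)
  ultimately show ?thesis
    by (simp add: sum_card_mult finite_around card_Un_disjoint finite_triples)
qed

text \<open>When the two other positions lie on opposite sides of \<open>x\<close>, the order is forced and only one
  pattern arises.\<close>

lemma sum_after_before: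
  "(\<Sum>x<n. card (same_after f n x) * card (diff_before f x)) = card (triples_211 f n)"
proof -
  let ?g = "\<lambda>(i, j, k). (j, k, i)"
  have "(SIGMA x:{..<n}. same_after f n x \<times> diff_before f x) = ?g ` triples_211 f n"
    by (force simp: around_defs triples_211_def image_iff)
  moreover have "card (?g ` triples_211 f n) = card (triples_211 f n)"
    by (intro card_image inj_onI; auto)
  ultimately show ?thesis
    by (simp add: sum_card_mult finite_around)
qed

lemma sum_before_after:
  "(\<Sum>x<n. card (same_before f x) * card (diff_after f n x)) = card (triples_112 f n)"
proof -
  let ?g = "\<lambda>(i, j, k). (j, i, k)"
  have "(SIGMA x:{..<n}. same_before f x \<times> diff_after f n x) = ?g ` triples_112 f n"
    by (force simp: around_defs triples_112_def image_iff)
  moreover have "card (?g ` triples_112 f n) = card (triples_112 f n)"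
    by (intro card_image inj_onI; auto)
  ultimately show ?thesis
    by (simp add: sum_card_mult finite_around)
qed

definition same_excess :: "(nat \<Rightarrow> 'a) \<Rightarrow> nat \<Rightarrow> nat \<Rightarrow> real" where
  "same_excess f n x = real (card (same_before f x)) - real (card (same_after f n x))"

definition diff_excess :: "(nat \<Rightarrow> 'a) \<Rightarrow> nat \<Rightarrow> nat \<Rightarrow> real" where
  "diff_excess f n x = real (card (diff_before f x)) - real (card (diff_after f n x))"

text \<open>The letters cancel out of the sum of the two excesses; this makes the upper bound
  independent of the word.\<close>

lemma same_plus_diff_excess:
  assumes "x < n"
  shows "same_excess f n x + diff_excess f n x = 2 * real x + 1 - real n"
proof -
  have "real (card (same_before f x)) + real (card (diff_before f x)) = real x"
    using card_before[of f x] by linarith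
  moreover have "real (card (same_after f n x)) + real (card (diff_after f n x)) = real n - 1 - real x"
    using card_after[of f n x] assms by linarith
  ultimately show ?thesis
    by (simp add: same_excess_def diff_excess_def)
qed

text \<open>Each copy of \<open>121\<close> is counted at its first and at its last position; the patterns \<open>112\<close>
  and \<open>211\<close> are each counted at one end with sign \<open>+\<close> and at the middle with sign \<open>-\<close>.\<close>

lemma card_triples_121:
  "2 * real (card (triples_121 f n)) = (\<Sum>x<n. same_excess f n x * diff_excess f n x)"
proof -
  have "(\<Sum>x<n. same_excess f n x * diff_excess f n x) =
      real (\<Sum>x<n. card (same_before f x) * card (diff_before f x)) +
      real (\<Sum>x<n. card (same_after f n x) * card (diff_after f n x)) -
      real (\<Sum>x<n. card (same_after f n x) * card (diff_before f x)) -
      real (\<Sum>x<n. card (same_before f x) * card (diff_after f n x))"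
    by (simp add: same_excess_def diff_excess_def algebra_simps sum.distrib sum_subtractf)
  then show ?thesis
    by (simp only: sum_before_before sum_after_after sum_after_before sum_before_after of_nat_add)
qed

lemma sum_centered_squares:
  "(\<Sum>x<n. (2 * real x + 1 - real n)\<^sup>2) = real n * ((real n)\<^sup>2 - 1) / 3"
proof -
  \<comment> \<open>Induction needs the center of the squares to stay fixed while the range grows.\<close>
  have "(\<Sum>x<m. (2 * real x + 1 - c)\<^sup>2) =
      real m * (4 * (real m)\<^sup>2 - 1) / 3 - 2 * c * (real m)\<^sup>2 + real m * c\<^sup>2" for m :: nat and c :: real
    by (induction m) (simp_all add: field_simps power2_eq_square)
  from this[where m = n and c = "real n"] show ?thesis
    by (simp add: field_simps power2_eq_square)
qed

text \<open>The inequality \<open>u v \<le> (u + v)\<^sup>2 / 4\<close> at every position.\<close>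

lemma copies_121_le:
  "real (copies [1, 2, 1] w) \<le> real (length w) * ((real (length w))\<^sup>2 - 1) / 24"
proof -
  define n where "n = length w"
  have "2 * real (copies [1, 2, 1] w) =
      (\<Sum>x<n. same_excess ((!) w) n x * diff_excess ((!) w) n x)"
    unfolding copies_121 n_def by (rule card_triples_121)
  also have "\<dots> \<le> (\<Sum>x<n. (2 * real x + 1 - real n)\<^sup>2 / 4)"
  proof (rule sum_mono)
    fix x assume "x \<in> {..<n}"
    then have "2 * real x + 1 - real n = same_excess ((!) w) n x + diff_excess ((!) w) n x"
      by (simp add: same_plus_diff_excess)
    moreover have "a * b \<le> (a + b)\<^sup>2 / 4" for a b :: real
      using zero_le_power2[of "a - b"] by (simp add: power2_eq_square algebra_simps)
    ultimately show "same_excess ((!) w) n x * diff_excess ((!) w) n x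
        \<le> (2 * real x + 1 - real n)\<^sup>2 / 4"
      by simp
  qed
  also have "\<dots> = real n * ((real n)\<^sup>2 - 1) / 12"
    unfolding sum_divide_distrib[symmetric] sum_centered_squares by simp
  finally show ?thesis
    by (simp add: n_def)
qed

section \<open>The alternating word\<close>

definition alternating :: "nat \<Rightarrow> nat list" where
  "alternating n = map (\<lambda>i. if even i then 1 else 2) [0..<n]"

lemma length_alternating [simp]: "length (alternating n) = n"
  by (simp add: alternating_def)

lemma nth_alternating [simp]: "i < n \<Longrightarrow> alternating n ! i = (if even i then 1 else 2)"
  by (simp add: alternating_def)

text \<open>Around \<open>x\<close>, the positions with the same letter are those at an even distance from \<open>x\<close>.\<close>

lemma card_same_before_alternating:
  assumes "x < n"
  shows "card (same_before ((!) (alternating n)) x) = x div 2"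
proof -
  have "same_before ((!) (alternating n)) x = (\<lambda>s. x - 2 * Suc s) ` {..<x div 2}"
  proof (intro equalityI subsetI)
    fix y assume "y \<in> same_before ((!) (alternating n)) x"
    then have "y < x" "even y \<longleftrightarrow> even x"
      using assms by (auto simp: same_before_def split: if_splits)
    then have "(x - y) div 2 - 1 < x div 2" "y = x - 2 * Suc ((x - y) div 2 - 1)"
      by presburger+
    then show "y \<in> (\<lambda>s. x - 2 * Suc s) ` {..<x div 2}"
      by blast
  next
    fix y assume "y \<in> (\<lambda>s. x - 2 * Suc s) ` {..<x div 2}"
    then obtain s where "s < x div 2" "y = x - 2 * Suc s"
      by blast
    then have "y < x" "even y \<longleftrightarrow> even x"
      by presburger+
    then show "y \<in> same_before ((!) (alternating n)) x"
      using assms by (simp add: same_before_def)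
  qed
  moreover have "inj_on (\<lambda>s. x - 2 * Suc s) {..<x div 2}"
    by (rule inj_onI) auto
  ultimately show ?thesis
    by (simp add: card_image)
qed

lemma card_same_after_alternating:
  assumes "x < n"
  shows "card (same_after ((!) (alternating n)) n x) = (n - 1 - x) div 2"
proof -
  have "same_after ((!) (alternating n)) n x = (\<lambda>s. x + 2 * Suc s) ` {..<(n - 1 - x) div 2}"
  proof (intro equalityI subsetI)
    fix y assume "y \<in> same_after ((!) (alternating n)) n x"
    then have "x < y" "y < n" "even y \<longleftrightarrow> even x"
      using assms by (auto simp: same_after_def split: if_splits)
    then have "(y - x) div 2 - 1 < (n - 1 - x) div 2" "y = x + 2 * Suc ((y - x) div 2 - 1)"
      by presburger+
    then show "y \<in> (\<lambda>s. x + 2 * Suc s) ` {..<(n - 1 - x) div 2}"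
      by blast
  next
    fix y assume "y \<in> (\<lambda>s. x + 2 * Suc s) ` {..<(n - 1 - x) div 2}"
    then obtain s where "s < (n - 1 - x) div 2" "y = x + 2 * Suc s"
      by blast
    then have "x < y" "y < n" "even y \<longleftrightarrow> even x"
      by presburger+
    then show "y \<in> same_after ((!) (alternating n)) n x"
      using assms by (simp add: same_after_def)
  qed
  moreover have "inj_on (\<lambda>s. x + 2 * Suc s) {..<(n - 1 - x) div 2}"
    by (rule inj_onI) auto
  ultimately show ?thesis
    by (simp add: card_image)
qed

text \<open>Rounding down in \<open>x div 2\<close> and \<open>(n - 1 - x) div 2\<close> moves \<open>same_excess\<close> away from half of
  \<open>2 x + 1 - n\<close> by at most \<open>1 / 2\<close>, which costs at most \<open>1 / 4\<close> in the product of the excesses.\<close>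

lemma copies_121_alternating_ge:
  "real n * ((real n)\<^sup>2 - 4) / 24 \<le> real (copies [1, 2, 1] (alternating n))"
proof -
  let ?s = "same_excess ((!) (alternating n)) n"
  let ?d = "diff_excess ((!) (alternating n)) n"
  have "real n * ((real n)\<^sup>2 - 4) / 12 = (\<Sum>x<n. (2 * real x + 1 - real n)\<^sup>2 / 4 - 1 / 4)"
    unfolding sum_subtractf sum_divide_distrib[symmetric] sum_centered_squares
    by (simp add: field_simps)
  also have "\<dots> \<le> (\<Sum>x<n. ?s x * ?d x)"
  proof (rule sum_mono)
    fix x assume "x \<in> {..<n}"
    then have x: "x < n"
      by simp
    define p where "p = x div 2"
    define q where "q = (n - 1 - x) div 2"
    have p: "2 * p \<le> x" "x \<le> 2 * p + 1"
      unfolding p_def by presburger+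
    have q: "2 * q + x + 1 \<le> n" "n \<le> 2 * q + x + 2"
      using x unfolding q_def by presburger+
    have s: "?s x = real p - real q"
      using x by (simp add: same_excess_def card_same_before_alternating
          card_same_after_alternating p_def q_def)
    \<comment> \<open>the rounding error: the amount by which \<open>diff_excess\<close> exceeds \<open>same_excess\<close>\<close>
    define e where "e = 2 * real x + 1 - real n - 2 * ?s x"
    have "\<bar>e\<bar> \<le> 1"
      using p q by (simp add: e_def s)
    then have "e\<^sup>2 \<le> 1"
      by (simp add: abs_square_le_1)
    moreover have "2 * real x + 1 - real n = 2 * ?s x + e"
      by (simp add: e_def)
    moreover have "?d x = ?s x + e"
      using same_plus_diff_excess[OF x, of "(!) (alternating n)"] by (simp add: e_def)
    ultimately show "(2 * real x + 1 - real n)\<^sup>2 / 4 - 1 / 4 \<le> ?s x * ?d x"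
      by (simp add: power2_eq_square algebra_simps)
  qed
  also have "\<dots> = 2 * real (copies [1, 2, 1] (alternating n))"
    by (simp only: copies_121 card_triples_121 length_alternating)
  finally show ?thesis
    by simp
qed

lemma alternating_in_partition_words:
  assumes "2 \<le> n" "2 \<le> k"
  shows "alternating n \<in> partition_words n k"
proof -
  define A where "A = {i \<in> {1..n}. odd i}"
  define B where "B = {i \<in> {1..n}. even i}"
  have "1 \<in> A" "2 \<in> B"
    using assms by (auto simp: A_def B_def)
  have "Min A = 1"
    using \<open>1 \<in> A\<close> by (intro Min_eqI) (auto simp: A_def)
  moreover have "Min B = 2"
    using \<open>2 \<in> B\<close> by (intro Min_eqI) (auto simp: B_def elim: evenE)
  moreover have "partition_on {1..n} {A, B}"
  proof -
    have "A \<union> B = {1..n}" "A \<inter> B = {}"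
      by (auto simp: A_def B_def)
    then show ?thesis
      using \<open>1 \<in> A\<close> \<open>2 \<in> B\<close> unfolding partition_on_def disjoint_def by blast
  qed
  ultimately have "ordered_blocks n [A, B]"
    by (simp add: ordered_blocks_def)
  moreover have "is_partition_word n [A, B] (alternating n)"
    unfolding is_partition_word_def
  proof (intro conjI ballI)
    fix i j assume "i \<in> {1..n}" "j \<in> {1..length [A, B]}"
    then have "1 \<le> i" "i \<le> n" "j = 1 \<or> j = 2"
      by auto
    then show "alternating n ! (i - 1) = j \<longleftrightarrow> i \<in> [A, B] ! (j - 1)"
      by (auto simp: A_def B_def)
  qed simp
  ultimately show ?thesis
    using assms unfolding partition_words_def by force
qed

section \<open>The packing density\<close>

lemma length_partition_word: "w \<in> partition_words n k \<Longrightarrow> length w = n"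
  unfolding partition_words_def is_partition_word_def by blast

text \<open>The blocks are listed by strictly increasing minima, and these are distinct elements of
  \<open>{1..n}\<close>.\<close>

lemma length_ordered_blocks_le:
  assumes "ordered_blocks n Bs"
  shows "length Bs \<le> n"
proof -
  have part: "partition_on {1..n} (set Bs)" and sorted: "sorted_wrt (\<lambda>A B. Min A < Min B) Bs"
    using assms by (auto simp: ordered_blocks_def)
  have "sorted_wrt (<) (map Min Bs)"
    using sorted by (simp add: sorted_wrt_map)
  then have "distinct (map Min Bs)"
    by (simp add: strict_sorted_iff)
  moreover have "set (map Min Bs) \<subseteq> {1..n}"
  proof
    fix m assume "m \<in> set (map Min Bs)"
    then obtain B where B: "B \<in> set Bs" "m = Min B"
      by auto
    then have "B \<subseteq> {1..n}" "B \<noteq> {}"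
      using part by (auto simp: partition_on_def)
    then show "m \<in> {1..n}"
      using B(2) Min_in[of B] finite_subset[of B "{1..n}"] by blast
  qed
  ultimately show ?thesis
    using card_mono[of "{1..n}" "set (map Min Bs)"] distinct_card[of "map Min Bs"] by simp
qed

lemma partition_words_eq:
  assumes "n \<le> k"
  shows "partition_words n k = partition_words n n"
  unfolding partition_words_def
  using assms length_ordered_blocks_le le_trans by blast

text \<open>Finiteness is needed for \<open>Max\<close> to be a genuine maximum. It holds because every position lies
  in some block, so that every letter is the index of a block.\<close>

lemma finite_partition_words: "finite (partition_words n k)"
proof (rule finite_subset)
  show "partition_words n k \<subseteq> {w. set w \<subseteq> {1..n} \<and> length w = n}"
  proof
    fix w assume "w \<in> partition_words n k"
    then obtain Bs where Bs: "ordered_blocks n Bs" "is_partition_word n Bs w"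
      by (auto simp: partition_words_def)
    have "w ! m \<in> {1..n}" if "m < n" for m
    proof -
      have "Suc m \<in> \<Union> (set Bs)"
        using Bs(1) that by (simp add: ordered_blocks_def partition_on_def)
      then obtain j where j: "j < length Bs" "Suc m \<in> Bs ! j"
        by (auto simp: in_set_conv_nth)
      have "Suc m \<in> {1..n}" "Suc j \<in> {1..length Bs}"
        using j(1) that by auto
      then have "w ! (Suc m - 1) = Suc j \<longleftrightarrow> Suc m \<in> Bs ! (Suc j - 1)"
        using Bs(2) unfolding is_partition_word_def by blast
      then show ?thesis
        using j length_ordered_blocks_le[OF Bs(1)] by simp
    qed
    then show "w \<in> {w. set w \<subseteq> {1..n} \<and> length w = n}"
      using Bs(2) by (auto simp: is_partition_word_def in_set_conv_nth subset_iff)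
  qed
  show "finite {w. set w \<subseteq> {1..n} \<and> length w = n}"
    by (rule finite_lists_length_eq) simp
qed

lemma max_density_LIMSEQ: "(\<lambda>k. max_density p n k) \<longlonglongrightarrow> max_density p n n"
proof (rule tendsto_eventually, rule eventually_sequentiallyI[of n])
  fix k assume "n \<le> k"
  then have "partition_words n k = partition_words n n"
    by (rule partition_words_eq)
  then show "max_density p n k = max_density p n n"
    by (simp only: max_density_def)
qed

text \<open>The exact quotients are \<open>(n + 1) / (4 (n - 2))\<close> above and \<open>(n + 2) / (4 (n - 1))\<close> below;
  they are relaxed to bounds whose limits are immediate.\<close>

lemma max_density_121_bounds:
  assumes "3 \<le> n"
  shows "max_density [1, 2, 1] n n \<le> 1 / 4 + 3 / real n"
    and "1 / 4 \<le> max_density [1, 2, 1] n n"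
proof -
  define M where "M = Max (copies [1, 2, 1] ` partition_words n n)"
  have fin: "finite (copies [1, 2, 1] ` partition_words n n)"
    by (simp add: finite_partition_words)
  have alt: "alternating n \<in> partition_words n n"
    using assms by (intro alternating_in_partition_words) auto
  then have "M \<in> copies [1, 2, 1] ` partition_words n n"
    unfolding M_def using fin by (intro Max_in) auto
  then obtain w :: "nat list" where "M = copies [1, 2, 1] w" "length w = n"
    using length_partition_word by blast
  then have upper: "real M \<le> real n * ((real n)\<^sup>2 - 1) / 24"
    using copies_121_le[of w] by simp
  have "copies [1, 2, 1] (alternating n) \<le> M"
    unfolding M_def using fin alt by (intro Max_ge) auto
  then have lower: "real n * ((real n)\<^sup>2 - 4) / 24 \<le> real M"
    using copies_121_alternating_ge[of n] by linarith
  have binom: "real (n choose 3) = real n * (real n - 1) * (real n - 2) / 6"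
    by (simp add: binomial_gbinomial gbinomial_prod_rev numeral_3_eq_3 fact_numeral)
  have dens: "max_density [1, 2, 1] n n = real M / (real n * (real n - 1) * (real n - 2) / 6)"
  proof -
    have "length [1, 2, 1 :: nat] = 3"
      by simp
    then show ?thesis
      unfolding max_density_def M_def by (simp only: binom)
  qed
  have n: "real n \<ge> 3"
    using assms by simp
  then have pos: "0 < real n * (real n - 1) * (real n - 2) / 6"
    by simp
  have "real n * (real n + 1) \<le> (real n + 12) * (real n - 2)"
    using n by (simp add: algebra_simps)
  then have "(real n - 1) * (real n * (real n + 1)) / 24 \<le>
      (real n - 1) * ((real n + 12) * (real n - 2)) / 24"
    using n by (intro divide_right_mono mult_left_mono) auto
  moreover have "(real n - 1) * (real n * (real n + 1)) / 24 = real n * ((real n)\<^sup>2 - 1) / 24"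
    by (simp add: algebra_simps power2_eq_square)
  moreover have "(real n - 1) * ((real n + 12) * (real n - 2)) / 24 =
      (1 / 4 + 3 / real n) * (real n * (real n - 1) * (real n - 2) / 6)"
  proof -
    have "1 / 4 + 3 / real n = (real n + 12) / (4 * real n)"
      using n by (simp add: field_simps)
    then show ?thesis
      using n by simp
  qed
  ultimately have "real M \<le> (1 / 4 + 3 / real n) * (real n * (real n - 1) * (real n - 2) / 6)"
    using upper by linarith
  then show "max_density [1, 2, 1] n n \<le> 1 / 4 + 3 / real n"
    unfolding dens pos_divide_le_eq[OF pos] .
  have "real n * (real n - 2) * (real n - 1) / 24 \<le> real n * (real n - 2) * (real n + 2) / 24"
    using n by (intro divide_right_mono mult_left_mono) auto
  moreover have "real n * (real n - 2) * (real n + 2) / 24 = real n * ((real n)\<^sup>2 - 4) / 24"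
    by (simp add: algebra_simps power2_eq_square)
  moreover have "real n * (real n - 2) * (real n - 1) / 24 =
      1 / 4 * (real n * (real n - 1) * (real n - 2) / 6)"
    by (simp add: field_simps)
  ultimately have "1 / 4 * (real n * (real n - 1) * (real n - 2) / 6) \<le> real M"
    using lower by linarith
  then show "1 / 4 \<le> max_density [1, 2, 1] n n"
    unfolding dens pos_le_divide_eq[OF pos] .
qed

theorem mainTheorem6:
  shows "(\<forall>n\<ge>3. convergent (\<lambda>k. max_density [1, 2, 1] n k)) \<and>
    convergent (\<lambda>n. lim (\<lambda>k. max_density [1, 2, 1] n k)) \<and>
    packing_density [1, 2, 1] = 1 / 4"
proof -
  have "(\<lambda>n. max_density [1, 2, 1] n n) \<longlonglongrightarrow> 1 / 4"
  proof (rule real_tendsto_sandwich)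
    show "(\<lambda>n. 1 / 4 :: real) \<longlonglongrightarrow> 1 / 4"
      by (rule tendsto_const)
    show "(\<lambda>n. 1 / 4 + 3 / real n) \<longlonglongrightarrow> 1 / 4"
      using tendsto_add[OF tendsto_const lim_const_over_n, of "1 / 4" 3] by simp
    show "\<forall>\<^sub>F n in sequentially. 1 / 4 \<le> max_density [1, 2, 1] n n"
      using max_density_121_bounds(2) by (rule eventually_sequentiallyI)
    show "\<forall>\<^sub>F n in sequentially. max_density [1, 2, 1] n n \<le> 1 / 4 + 3 / real n"
      using max_density_121_bounds(1) by (rule eventually_sequentiallyI)
  qed
  then have "(\<lambda>n. lim (\<lambda>k. max_density [1, 2, 1] n k)) \<longlonglongrightarrow> 1 / 4"
    by (simp add: limI[OF max_density_LIMSEQ])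
  then show ?thesis
    using max_density_LIMSEQ by (auto simp: packing_density_def convergent_def limI)
qed

end
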